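(* Let $H$ be a $\mathbb{Z}^n$-bigraded Hopf algebra and $A$ a $\mathbb{Z}^n$-bigraded right $H$-comodule algebra (in the sense of the context) with coaction $\delta^A$, such that $B=A^{\mathrm{co}H}\subseteq A$ is an $H$-Hopf--Galois extension, and let $\theta$ be a real skew-symmetric $n\times n$ matrix. The bigradings give the deformed algebras $H_\Theta=(H,\cdot_\Theta)$ and $A_\Theta=(A,\cdot_\Theta)$, where $H_\Theta$ is a Hopf algebra with the coproduct, counit and antipode of $H$. Then $A_\Theta$ is an $H_\Theta$-comodule algebra with the same coaction, viewed as a map $\delta^A_\Theta:A_\Theta\to A_\Theta\otimes H_\Theta$. Moreover, the coinvariant subspace $B_\Theta=A_\Theta^{\mathrm{co}H_\Theta}$ has the same underlying vector space as $B=A^{\mathrm{co}H}$ and is a subalgebra of $A_\Theta$; that is, $$B_\Theta=A_\Theta^{\mathrm{co}H_\Theta}=(A^{\mathrm{co}H},\cdot_\Theta)=(B,\cdot_\Theta).$$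
   Context: All algebras are unital associative over $\mathbb{C}$ and $\otimes=\otimes_{\mathbb{C}}$. A $\mathbb{Z}^n$-bigraded Hopf algebra is a Hopf algebra $H=\bigoplus_{r,s\in\mathbb{Z}^n}H_{(r,s)}$ such that: (i) $H_{(r,s)}\cdot H_{(p,q)}\subset H_{(r+p,s+q)}$; (ii) $\Delta(H_{(r,l)})\subset\bigoplus_{s\in\mathbb{Z}^n}H_{(r,s)}\otimes H_{(s,l)}$; (iii) $\varepsilon(h)=0$ for $h\in H_{(r,l)}$ with $r\ne l$; (iv) the antipode satisfies $S(H_{(r,l)})\subset H_{(-l,-r)}$ (and, if $H$ has a $*$-structure, $(H_{(r,l)})^*\subset H_{(-r,-l)}$). A $\mathbb{Z}^n$-bigraded $H$-comodule algebra is a right $H$-comodule algebra $A=\bigoplus_{r,s\in\mathbb{Z}^n}A_{(r,s)}$ with $A_{(r,s)}A_{(p,q)}\subset A_{(r+p,s+q)}$ and $\delta^A(A_{(r,l)})\subset\bigoplus_{s\in\mathbb{Z}^n}A_{(r,s)}\otimes H_{(s,l)}$. Let $\lambda_\theta(r,l)=e^{\pi i\langle\theta r,l\rangle}$ for $r,l\in\mathbb{Z}^n$, with $\langle\cdot,\cdot\rangle$ the standard pairing, and $\Theta=\begin{pmatrix}\theta&0\\0&-\theta\end{pmatrix}$. On $H$ and on $A$ the deformed product of homogeneous elements $x,y$ of bidegrees $(r_1,r_2)$, $(l_1,l_2)$ is $x\cdot_\Theta y=\lambda_\theta(r_1,l_1)\,\lambda_{-\theta}(r_2,l_2)\,xy$,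 extended bilinearly. Coinvariants: $A^{\mathrm{co}H}=\{b\in A:\delta^A(b)=b\otimes1_H\}$. Write $\delta^A(a)=a_{(0)}\otimes a_{(1)}$. $B=A^{\mathrm{co}H}\subseteq A$ is an $H$-Hopf--Galois extension if $\chi:A\otimes_BA\to A\otimes H$, $\tilde a\otimes_Ba\mapsto\tilde aa_{(0)}\otimes a_{(1)}$, is an isomorphism. *)

theory Defs
  imports "HOL-Analysis.Analysis" "HOL-Library.Poly_Mapping"
begin

section \<open>Complex vector spaces\<close>

class scaleC =
  fixes scaleC :: "complex \<Rightarrow> 'a \<Rightarrow> 'a"  (infixr "*\<^sub>C" 75)

class complex_vector = scaleC + ab_group_add +
  assumes scaleC_add_right: "a *\<^sub>C (x + y) = a *\<^sub>C x + a *\<^sub>C y"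
    and scaleC_add_left: "(a + b) *\<^sub>C x = a *\<^sub>C x + b *\<^sub>C x"
    and scaleC_scaleC: "a *\<^sub>C b *\<^sub>C x = (a * b) *\<^sub>C x"
    and scaleC_one: "1 *\<^sub>C x = x"

global_interpretation complex_vector: vector_space "scaleC :: complex \<Rightarrow> 'a \<Rightarrow> 'a::complex_vector"
  by unfold_locales (auto simp: scaleC_add_right scaleC_add_left scaleC_scaleC scaleC_one)

abbreviation csubspace :: "'a::complex_vector set \<Rightarrow> bool"
  where "csubspace \<equiv> module.subspace scaleC"

abbreviation cspan :: "'a::complex_vector set \<Rightarrow> 'a set"
  where "cspan \<equiv> module.span scaleC"

abbreviation clinear :: "('a::complex_vector \<Rightarrow> 'b::complex_vector) \<Rightarrow> bool"
  where "clinear \<equiv> Vector_Spaces.linear scaleC scaleC"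

definition cbilinear :: "('a::complex_vector \<Rightarrow> 'b::complex_vector \<Rightarrow> 'c::complex_vector) \<Rightarrow> bool"
  where "cbilinear f \<longleftrightarrow> (\<forall>a. clinear (f a)) \<and> (\<forall>b. clinear (\<lambda>a. f a b))"

lemma clinear_iff:
  "clinear f \<longleftrightarrow> (\<forall>x y. f (x + y) = f x + f y) \<and> (\<forall>c x. f (c *\<^sub>C x) = c *\<^sub>C f x)"
  unfolding Vector_Spaces.linear_def module_hom_def module_hom_axioms_def
  using complex_vector.vector_space_axioms[where 'a = 'a] complex_vector.vector_space_axioms[where 'a = 'b]
    complex_vector.module_axioms[where 'a = 'a] complex_vector.module_axioms[where 'a = 'b]
  by blast

instantiation complex :: complex_vector
begin
definition scaleC_complex_def: "c *\<^sub>C (z::complex) = c * z"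
instance by standard (auto simp: scaleC_complex_def algebra_simps)
end

text \<open>The vector space with basis \<open>'k\<close> is \<open>'k \<Rightarrow>\<^sub>0 complex\<close>.\<close>

instantiation poly_mapping :: (type, complex_vector) complex_vector
begin
definition scaleC_poly_mapping_def: "c *\<^sub>C p = Poly_Mapping.map (scaleC c) p"
instance
proof
  have lk: "Poly_Mapping.lookup (c *\<^sub>C p) k = c *\<^sub>C Poly_Mapping.lookup p k" for c and p :: "'a \<Rightarrow>\<^sub>0 'b" and k
    by (simp add: scaleC_poly_mapping_def Poly_Mapping.map.rep_eq when_def)
  fix a b :: complex and x y :: "'a \<Rightarrow>\<^sub>0 'b"
  show "a *\<^sub>C (x + y) = a *\<^sub>C x + a *\<^sub>C y"
    by (rule poly_mapping_eqI) (simp add: lk lookup_add scaleC_add_right)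
  show "(a + b) *\<^sub>C x = a *\<^sub>C x + b *\<^sub>C x"
    by (rule poly_mapping_eqI) (simp add: lk lookup_add scaleC_add_left)
  show "a *\<^sub>C b *\<^sub>C x = (a * b) *\<^sub>C x"
    by (rule poly_mapping_eqI) (simp add: lk scaleC_scaleC)
  show "1 *\<^sub>C x = x"
    by (rule poly_mapping_eqI) (simp add: lk scaleC_one)
qed
end

lemma lookup_scaleC: "Poly_Mapping.lookup (c *\<^sub>C p) k = c *\<^sub>C Poly_Mapping.lookup p k"
  by (simp add: scaleC_poly_mapping_def Poly_Mapping.map.rep_eq when_def)


section \<open>Tensor products over the complex numbers\<close>

definition tensor_relators :: "('a::complex_vector \<times> 'b::complex_vector \<Rightarrow>\<^sub>0 complex) set"
  where "tensor_relators =
      {Poly_Mapping.single (a + a', b) 1 - Poly_Mapping.single (a, b) 1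
         - Poly_Mapping.single (a', b) 1 | a a' b. True}
    \<union> {Poly_Mapping.single (a, b + b') 1 - Poly_Mapping.single (a, b) 1
         - Poly_Mapping.single (a, b') 1 | a b b'. True}
    \<union> {Poly_Mapping.single (c *\<^sub>C a, b) 1 - c *\<^sub>C Poly_Mapping.single (a, b) 1 | c a b. True}
    \<union> {Poly_Mapping.single (a, c *\<^sub>C b) 1 - c *\<^sub>C Poly_Mapping.single (a, b) 1 | c a b. True}"

definition tensor_rel ::
    "('a::complex_vector \<times> 'b::complex_vector \<Rightarrow>\<^sub>0 complex) \<Rightarrow> ('a \<times> 'b \<Rightarrow>\<^sub>0 complex) \<Rightarrow> bool"
  where "tensor_rel p q \<longleftrightarrow> p - q \<in> cspan tensor_relators"

lemma equivp_tensor_rel: "equivp tensor_rel"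
proof (rule equivpI)
  show "reflp tensor_rel"
    by (auto simp: reflp_def tensor_rel_def complex_vector.span_zero)
  show "symp tensor_rel"
    by (auto simp: symp_def tensor_rel_def dest: complex_vector.span_neg)
  show "transp tensor_rel"
    by (auto simp: transp_def tensor_rel_def dest: complex_vector.span_add)
qed

quotient_type (overloaded) ('a, 'b) tensor =
    "('a::complex_vector \<times> 'b::complex_vector \<Rightarrow>\<^sub>0 complex)" / tensor_rel
  by (rule equivp_tensor_rel)

lemma abs_tensor_ex: "\<exists>p. t = abs_tensor p"
  by (metis Quotient3_abs_rep Quotient3_tensor)

instantiation tensor :: (complex_vector, complex_vector) complex_vector
begin

lift_definition zero_tensor :: "('a, 'b) tensor" is 0 .

lift_definition plus_tensor :: "('a, 'b) tensor \<Rightarrow> ('a, 'b) tensor \<Rightarrow> ('a, 'b) tensor" is "(+)"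
  by (auto simp: tensor_rel_def add_diff_add intro: complex_vector.span_add)

lift_definition minus_tensor :: "('a, 'b) tensor \<Rightarrow> ('a, 'b) tensor \<Rightarrow> ('a, 'b) tensor" is "(-)"
proof -
  fix p p' q q' :: "'a \<times> 'b \<Rightarrow>\<^sub>0 complex"
  assume "tensor_rel p p'" "tensor_rel q q'"
  then have "(p - p') - (q - q') \<in> cspan tensor_relators"
    unfolding tensor_rel_def by (rule complex_vector.span_diff)
  moreover have "(p - q) - (p' - q') = (p - p') - (q - q')"
    by simp
  ultimately show "tensor_rel (p - q) (p' - q')"
    unfolding tensor_rel_def by (simp only:)
qed

lift_definition uminus_tensor :: "('a, 'b) tensor \<Rightarrow> ('a, 'b) tensor" is uminus
proof -
  fix p q :: "'a \<times> 'b \<Rightarrow>\<^sub>0 complex"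
  assume "tensor_rel p q"
  then have "- (p - q) \<in> cspan tensor_relators"
    unfolding tensor_rel_def by (rule complex_vector.span_neg)
  then show "tensor_rel (- p) (- q)"
    unfolding tensor_rel_def by (simp only: minus_diff_minus)
qed

lift_definition scaleC_tensor :: "complex \<Rightarrow> ('a, 'b) tensor \<Rightarrow> ('a, 'b) tensor" is scaleC
  by (auto simp: tensor_rel_def complex_vector.scale_right_diff_distrib[symmetric]
      intro: complex_vector.span_scale)

instance
proof
  fix r s t :: "('a, 'b) tensor" and a b :: complex
  obtain p q u where pqu: "r = abs_tensor p" "s = abs_tensor q" "t = abs_tensor u"
    using abs_tensor_ex by blast
  note abs = zero_tensor_def plus_tensor.abs_eq minus_tensor.abs_eq uminus_tensor.abs_eq
    scaleC_tensor.abs_eq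
  show "r + s + t = r + (s + t)" by (simp only: pqu abs add.assoc)
  show "r + s = s + r" by (simp only: pqu abs add.commute)
  show "0 + r = r" by (simp only: pqu abs add_0_left)
  show "- r + r = 0" by (simp only: pqu abs left_minus)
  show "r - s = r + - s" by (simp only: pqu abs diff_conv_add_uminus)
  show "a *\<^sub>C (r + s) = a *\<^sub>C r + a *\<^sub>C s" by (simp only: pqu abs scaleC_add_right)
  show "(a + b) *\<^sub>C r = a *\<^sub>C r + b *\<^sub>C r" by (simp only: pqu abs scaleC_add_left)
  show "a *\<^sub>C b *\<^sub>C r = (a * b) *\<^sub>C r" by (simp only: pqu abs scaleC_scaleC)
  show "1 *\<^sub>C r = r" by (simp only: pqu abs scaleC_one)
qed

end

lift_definition pure_tensor :: "'a::complex_vector \<Rightarrow> 'b::complex_vector \<Rightarrow> ('a, 'b) tensor"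
    (infixr "\<otimes>" 72)
  is "\<lambda>a b. Poly_Mapping.single (a, b) 1" .

lemma cbilinear_pure_tensor: "cbilinear (\<otimes>)"
  unfolding cbilinear_def clinear_iff
proof (intro conjI allI)
  fix a a' :: 'a and b b' :: 'b and c :: complex
  show "a \<otimes> (b + b') = a \<otimes> b + a \<otimes> b'"
    by transfer (unfold tensor_rel_def, rule complex_vector.span_base,
        unfold tensor_relators_def diff_diff_eq[symmetric], blast)
  show "(a + a') \<otimes> b = a \<otimes> b + a' \<otimes> b"
    by transfer (unfold tensor_rel_def, rule complex_vector.span_base,
        unfold tensor_relators_def diff_diff_eq[symmetric], blast)
  show "a \<otimes> (c *\<^sub>C b) = c *\<^sub>C (a \<otimes> b)"
    by transfer (unfold tensor_rel_def, rule complex_vector.span_base,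
        unfold tensor_relators_def, blast)
  show "(c *\<^sub>C a) \<otimes> b = c *\<^sub>C (a \<otimes> b)"
    by transfer (unfold tensor_rel_def, rule complex_vector.span_base,
        unfold tensor_relators_def, blast)
qed

lemma pure_tensor_linear:
  "(a + a') \<otimes> b = a \<otimes> b + a' \<otimes> b" "a \<otimes> (b + b') = a \<otimes> b + a \<otimes> b'"
  "(c *\<^sub>C a) \<otimes> b = c *\<^sub>C (a \<otimes> b)" "a \<otimes> (c *\<^sub>C b) = c *\<^sub>C (a \<otimes> b)"
  using cbilinear_pure_tensor unfolding cbilinear_def clinear_iff by blast+

definition tensor_lift ::
    "('a::complex_vector \<Rightarrow> 'b::complex_vector \<Rightarrow> 'c::complex_vector) \<Rightarrow> ('a, 'b) tensor \<Rightarrow> 'c"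
  where "tensor_lift f = (THE g. clinear g \<and> (\<forall>a b. g (a \<otimes> b) = f a b))"

lemma free_expansion: "p = (\<Sum>k\<in>Poly_Mapping.keys p. Poly_Mapping.lookup p k *\<^sub>C Poly_Mapping.single k 1)"
  for p :: "'k \<Rightarrow>\<^sub>0 complex"
proof (rule poly_mapping_eqI)
  fix k
  have "Poly_Mapping.lookup (\<Sum>j\<in>Poly_Mapping.keys p. Poly_Mapping.lookup p j *\<^sub>C Poly_Mapping.single j 1) k
      = (\<Sum>j\<in>Poly_Mapping.keys p. if j = k then Poly_Mapping.lookup p j else 0)"
    unfolding lookup_sum
    by (intro sum.cong) (simp_all add: lookup_scaleC lookup_single scaleC_complex_def when_def)
  also have "\<dots> = Poly_Mapping.lookup p k"
    by (simp add: in_keys_iff)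
  finally show "Poly_Mapping.lookup p k = Poly_Mapping.lookup (\<Sum>j\<in>Poly_Mapping.keys p. Poly_Mapping.lookup p j *\<^sub>C Poly_Mapping.single j 1) k" ..
qed

lemma tensor_induct [case_names pure add scale]:
  assumes pure: "\<And>a b. P (a \<otimes> b)"
    and add: "\<And>s t. P s \<Longrightarrow> P t \<Longrightarrow> P (s + t)"
    and scale: "\<And>c t. P t \<Longrightarrow> P (c *\<^sub>C t)"
  shows "P (t :: ('a::complex_vector, 'b::complex_vector) tensor)"
proof -
  define Q where "Q p = P (abs_tensor p)" for p :: "'a \<times> 'b \<Rightarrow>\<^sub>0 complex"
  have Qadd: "Q p \<Longrightarrow> Q q \<Longrightarrow> Q (p + q)" for p q
    using add[of "abs_tensor p" "abs_tensor q"] by (simp add: Q_def plus_tensor.abs_eq)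
  have Qscale: "Q p \<Longrightarrow> Q (c *\<^sub>C p)" for c p
    using scale[of "abs_tensor p" c] by (simp add: Q_def scaleC_tensor.abs_eq)
  have Qsingle: "Q (Poly_Mapping.single k 1)" for k
    using pure[of "fst k" "snd k"] by (simp add: Q_def pure_tensor.abs_eq)
  have Q0: "Q 0"
    using Qscale[OF Qsingle, of 0] by simp
  have "Q p" for p
  proof -
    have "finite S \<Longrightarrow> Q (\<Sum>k\<in>S. Poly_Mapping.lookup p k *\<^sub>C Poly_Mapping.single k 1)" for S
      by (induction S rule: finite_induct) (auto intro: Q0 Qadd Qscale Qsingle)
    then show ?thesis
      using free_expansion[of p] finite_keys[of p] by metis
  qed
  then show ?thesis
    using abs_tensor_ex[of t] by (auto simp: Q_def)
qed

lemma tensor_lift_ex1: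
  fixes f :: "'a::complex_vector \<Rightarrow> 'b::complex_vector \<Rightarrow> 'c::complex_vector"
  assumes f: "cbilinear f"
  shows "\<exists>!g. clinear g \<and> (\<forall>a b. g (a \<otimes> b) = f a b)"
proof (rule ex_ex1I)
  define F where "F p = (\<Sum>k\<in>Poly_Mapping.keys p. Poly_Mapping.lookup p k *\<^sub>C f (fst k) (snd k))"
    for p :: "'a \<times> 'b \<Rightarrow>\<^sub>0 complex"
  have F_eq: "F p = (\<Sum>k\<in>S. Poly_Mapping.lookup p k *\<^sub>C f (fst k) (snd k))"
    if "finite S" "Poly_Mapping.keys p \<subseteq> S" for p S
    unfolding F_def using that
    by (intro sum.mono_neutral_left) (auto simp: in_keys_iff)
  have F_add: "F (p + q) = F p + F q" for p q
  proof -
    have S: "finite (Poly_Mapping.keys p \<union> Poly_Mapping.keys q)" by simp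
    show ?thesis
      using F_eq[OF S, of p] F_eq[OF S, of q] F_eq[OF S, of "p + q"] keys_add[of p q]
      by (simp add: lookup_add scaleC_add_left sum.distrib)
  qed
  have F_scale: "F (c *\<^sub>C p) = c *\<^sub>C F p" for c p
  proof -
    have "Poly_Mapping.keys (c *\<^sub>C p) \<subseteq> Poly_Mapping.keys p"
      by (auto simp: in_keys_iff lookup_scaleC)
    then show ?thesis
      using F_eq[of "Poly_Mapping.keys p" "c *\<^sub>C p"]
      by (simp add: F_def lookup_scaleC complex_vector.scale_sum_right scaleC_complex_def
          scaleC_scaleC)
  qed
  have F_single: "F (Poly_Mapping.single k 1) = f (fst k) (snd k)" for k
    by (simp add: F_def scaleC_one)
  have F_diff: "F (p - q) = F p - F q" for p q
    using F_add[of "p - q" q] by (simp add: algebra_simps)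
  have fadd: "f (a + a') b = f a b + f a' b" "f a (b + b') = f a b + f a b'"
    "f (c *\<^sub>C a) b = c *\<^sub>C f a b" "f a (c *\<^sub>C b) = c *\<^sub>C f a b" for a a' b b' c
    using f by (auto simp: cbilinear_def clinear_iff)
  have sub: "csubspace {p. F p = 0}"
    unfolding complex_vector.subspace_def using F_add F_scale F_scale[of 0 0] by auto
  have "tensor_relators \<subseteq> {p. F p = 0}"
    by (auto simp: tensor_relators_def F_diff F_scale F_single fadd)
  then have "cspan tensor_relators \<subseteq> {p. F p = 0}"
    by (rule complex_vector.span_minimal[OF _ sub])
  then have F_cong: "F p = F q" if "tensor_rel p q" for p q
    using that F_diff[of p q] by (auto simp: tensor_rel_def)
  define g where "g t = F (rep_tensor t)" for t
  have g_abs: "g (abs_tensor p) = F p" for p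
    unfolding g_def by (rule F_cong)
      (metis Quotient3_tensor Quotient3_rep_abs equivp_tensor_rel equivp_reflp)
  have "clinear g"
    unfolding clinear_iff
  proof (intro conjI allI)
    fix s t :: "('a, 'b) tensor" and c
    obtain p q where "s = abs_tensor p" "t = abs_tensor q"
      using abs_tensor_ex by blast
    then show "g (s + t) = g s + g t" "g (c *\<^sub>C s) = c *\<^sub>C g s"
      by (simp_all add: g_abs plus_tensor.abs_eq scaleC_tensor.abs_eq F_add F_scale)
  qed
  moreover have "g (a \<otimes> b) = f a b" for a b
    by (simp add: pure_tensor.abs_eq g_abs F_single)
  ultimately show "\<exists>g. clinear g \<and> (\<forall>a b. g (a \<otimes> b) = f a b)" by blast
next
  fix g h :: "('a, 'b) tensor \<Rightarrow> 'c"
  assume "clinear g \<and> (\<forall>a b. g (a \<otimes> b) = f a b)" "clinear h \<and> (\<forall>a b. h (a \<otimes> b) = f a b)"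
  then have "g t = h t" for t
    by (induction t rule: tensor_induct) (auto simp: clinear_iff)
  then show "g = h" by (rule ext)
qed

lemma
  assumes "cbilinear f"
  shows clinear_tensor_lift: "clinear (tensor_lift f)"
    and tensor_lift_pure: "tensor_lift f (a \<otimes> b) = f a b"
  using theI'[OF tensor_lift_ex1[OF assms]] by (simp_all add: tensor_lift_def)

lemma clinear_tensor_eqI:
  assumes "clinear f" and "clinear g" and "\<And>a b. f (a \<otimes> b) = g (a \<otimes> b)"
  shows "f t = g t"
  using assms unfolding clinear_iff by (induction t rule: tensor_induct) simp_all

lemma clinear_tensor_lift_param:
  assumes F: "\<And>x. cbilinear (F x)" and lin: "\<And>a b. clinear (\<lambda>x. F x a b)"
  shows "clinear (\<lambda>x. tensor_lift (F x) t)"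
  unfolding clinear_iff
proof (intro conjI allI)
  fix x y c
  have l: "clinear (tensor_lift (F x))" for x
    by (rule clinear_tensor_lift[OF F])
  show "tensor_lift (F (x + y)) t = tensor_lift (F x) t + tensor_lift (F y) t"
  proof (rule clinear_tensor_eqI[where g = "\<lambda>t. tensor_lift (F x) t + tensor_lift (F y) t"])
    show "clinear (\<lambda>t. tensor_lift (F x) t + tensor_lift (F y) t)"
      using l[of x] l[of y] unfolding clinear_iff by (simp add: scaleC_add_right)
    show "tensor_lift (F (x + y)) (a \<otimes> b)
        = tensor_lift (F x) (a \<otimes> b) + tensor_lift (F y) (a \<otimes> b)" for a b
      using lin[of a b] unfolding clinear_iff by (simp add: tensor_lift_pure[OF F])
  qed (rule l)
  show "tensor_lift (F (c *\<^sub>C x)) t = c *\<^sub>C tensor_lift (F x) t"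
  proof (rule clinear_tensor_eqI[where g = "\<lambda>t. c *\<^sub>C tensor_lift (F x) t"])
    show "clinear (\<lambda>t. c *\<^sub>C tensor_lift (F x) t)"
      using l[of x] unfolding clinear_iff
      by (simp add: scaleC_add_right scaleC_scaleC mult.commute)
    show "tensor_lift (F (c *\<^sub>C x)) (a \<otimes> b) = c *\<^sub>C tensor_lift (F x) (a \<otimes> b)" for a b
      using lin[of a b] unfolding clinear_iff by (simp add: tensor_lift_pure[OF F])
  qed (rule l)
qed

definition tensor_map ::
    "('a::complex_vector \<Rightarrow> 'c::complex_vector) \<Rightarrow> ('b::complex_vector \<Rightarrow> 'd::complex_vector)
      \<Rightarrow> ('a, 'b) tensor \<Rightarrow> ('c, 'd) tensor"
  where "tensor_map f g = tensor_lift (\<lambda>a b. f a \<otimes> g b)"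

definition tensor_assoc ::
    "(('a::complex_vector, 'b::complex_vector) tensor, 'c::complex_vector) tensor
      \<Rightarrow> ('a, ('b, 'c) tensor) tensor"
  where "tensor_assoc = tensor_lift (\<lambda>s c. tensor_lift (\<lambda>a b. a \<otimes> (b \<otimes> c)) s)"


section \<open>Algebras, Hopf algebras and comodule algebras\<close>

text \<open>The product is a record field, not a type class operation, because the same vector
  space carries both the original and the deformed product.\<close>

record 'a calgebra =
  amult :: "'a \<Rightarrow> 'a \<Rightarrow> 'a"
  aunit :: 'a

record (overloaded) ('h::complex_vector) hopf = "'h calgebra" +
  comult :: "'h \<Rightarrow> ('h, 'h) tensor"
  counit :: "'h \<Rightarrow> complex"
  antipode :: "'h \<Rightarrow> 'h"

definition is_algebra :: "('a::complex_vector, 'z) calgebra_scheme \<Rightarrow> bool"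
  where "is_algebra A \<longleftrightarrow>
    cbilinear (amult A) \<and>
    (\<forall>x y z. amult A (amult A x y) z = amult A x (amult A y z)) \<and>
    (\<forall>x. amult A (aunit A) x = x \<and> amult A x (aunit A) = x)"

definition is_subalgebra :: "('a::complex_vector, 'z) calgebra_scheme \<Rightarrow> 'a set \<Rightarrow> bool"
  where "is_subalgebra A B \<longleftrightarrow>
    csubspace B \<and> aunit A \<in> B \<and> (\<forall>x\<in>B. \<forall>y\<in>B. amult A x y \<in> B)"

definition tensor_mult ::
    "('a::complex_vector, 'z) calgebra_scheme \<Rightarrow> ('b::complex_vector, 'w) calgebra_scheme
      \<Rightarrow> ('a, 'b) tensor \<Rightarrow> ('a, 'b) tensor \<Rightarrow> ('a, 'b) tensor"
  where "tensor_mult A B s t =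
    tensor_lift (\<lambda>a b. tensor_lift (\<lambda>a' b'. amult A a a' \<otimes> amult B b b') t) s"

definition hopf_algebra :: "('h::complex_vector, 'z) hopf_scheme \<Rightarrow> bool"
  where "hopf_algebra H \<longleftrightarrow>
    is_algebra H \<and>
    clinear (comult H) \<and> clinear (counit H) \<and> clinear (antipode H) \<and>
    (\<forall>h. tensor_assoc (tensor_map (comult H) id (comult H h)) = tensor_map id (comult H) (comult H h)) \<and>
    (\<forall>h. tensor_lift (\<lambda>a b. counit H a *\<^sub>C b) (comult H h) = h) \<and>
    (\<forall>h. tensor_lift (\<lambda>a b. counit H b *\<^sub>C a) (comult H h) = h) \<and>
    (\<forall>g h. comult H (amult H g h) = tensor_mult H H (comult H g) (comult H h)) \<and>
    comult H (aunit H) = aunit H \<otimes> aunit H \<and>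
    (\<forall>g h. counit H (amult H g h) = counit H g * counit H h) \<and>
    counit H (aunit H) = 1 \<and>
    (\<forall>h. tensor_lift (\<lambda>a b. amult H (antipode H a) b) (comult H h) = counit H h *\<^sub>C aunit H) \<and>
    (\<forall>h. tensor_lift (\<lambda>a b. amult H a (antipode H b)) (comult H h) = counit H h *\<^sub>C aunit H)"

definition comodule_algebra ::
    "('h::complex_vector, 'w) hopf_scheme \<Rightarrow> ('a::complex_vector, 'z) calgebra_scheme
      \<Rightarrow> ('a \<Rightarrow> ('a, 'h) tensor) \<Rightarrow> bool"
  where "comodule_algebra H A \<delta> \<longleftrightarrow>
    hopf_algebra H \<and> is_algebra A \<and> clinear \<delta> \<and>
    (\<forall>a. tensor_assoc (tensor_map \<delta> id (\<delta> a)) = tensor_map id (comult H) (\<delta> a)) \<and>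
    (\<forall>a. tensor_lift (\<lambda>b h. counit H h *\<^sub>C b) (\<delta> a) = a) \<and>
    (\<forall>a b. \<delta> (amult A a b) = tensor_mult A H (\<delta> a) (\<delta> b)) \<and>
    \<delta> (aunit A) = aunit A \<otimes> aunit H"

definition coinvariants ::
    "('h::complex_vector, 'w) hopf_scheme \<Rightarrow> ('a::complex_vector \<Rightarrow> ('a, 'h) tensor) \<Rightarrow> 'a set"
  where "coinvariants H \<delta> = {b. \<delta> b = b \<otimes> aunit H}"


section \<open>Hopf--Galois extensions\<close>

definition balanced_relators ::
    "('a::complex_vector, 'z) calgebra_scheme \<Rightarrow> 'a set \<Rightarrow> ('a, 'a) tensor set"
  where "balanced_relators A B = {amult A x b \<otimes> y - x \<otimes> amult A b y | x b y. b \<in> B}"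

text \<open>The elements of \<open>A \<otimes>\<^sub>B A\<close> are the cosets, as subsets of \<open>A \<otimes> A\<close>.\<close>

definition balanced_rel ::
    "('a::complex_vector, 'z) calgebra_scheme \<Rightarrow> 'a set \<Rightarrow> (('a, 'a) tensor \<times> ('a, 'a) tensor) set"
  where "balanced_rel A B = {(s, t). s - t \<in> cspan (balanced_relators A B)}"

definition balanced_tensor ::
    "('a::complex_vector, 'z) calgebra_scheme \<Rightarrow> 'a set \<Rightarrow> ('a, 'a) tensor set set"
  where "balanced_tensor A B = UNIV // balanced_rel A B"

definition pre_canonical_map ::
    "('a::complex_vector, 'z) calgebra_scheme \<Rightarrow> ('a \<Rightarrow> ('a, 'h::complex_vector) tensor)
      \<Rightarrow> ('a, 'a) tensor \<Rightarrow> ('a, 'h) tensor"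
  where "pre_canonical_map A \<delta> = tensor_lift (\<lambda>x a. tensor_map (amult A x) id (\<delta> a))"

definition canonical_map ::
    "('a::complex_vector, 'z) calgebra_scheme \<Rightarrow> ('a \<Rightarrow> ('a, 'h::complex_vector) tensor)
      \<Rightarrow> ('a, 'a) tensor set \<Rightarrow> ('a, 'h) tensor"
  where "canonical_map A \<delta> X = the_elem (pre_canonical_map A \<delta> ` X)"

lemma clinear_tensor_map:
  assumes f: "clinear f" and g: "clinear g"
  shows "clinear (tensor_map f g)" "tensor_map f g (a \<otimes> b) = f a \<otimes> g b"
proof -
  have "cbilinear (\<lambda>a b. f a \<otimes> g b)"
    using f g by (auto simp: cbilinear_def clinear_iff pure_tensor_linear)
  then show "clinear (tensor_map f g)" "tensor_map f g (a \<otimes> b) = f a \<otimes> g b"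
    by (simp_all add: tensor_map_def clinear_tensor_lift tensor_lift_pure)
qed

lemma pre_canonical_map_pure:
  fixes H :: "('h::complex_vector, 'w) hopf_scheme" and A :: "('a::complex_vector, 'z) calgebra_scheme"
  assumes "comodule_algebra H A \<delta>"
  shows "clinear (pre_canonical_map A \<delta>)"
    and "pre_canonical_map A \<delta> (x \<otimes> a) = tensor_map (amult A x) id (\<delta> a)"
proof -
  have bil: "cbilinear (amult A)" and lin: "clinear \<delta>"
    using assms by (auto simp: comodule_algebra_def is_algebra_def)
  have l: "clinear (amult A x)" for x
    using bil by (simp add: cbilinear_def)
  have i: "clinear (id :: 'h \<Rightarrow> 'h)"
    by (simp add: clinear_iff)
  have bl: "cbilinear (\<lambda>a b. amult A x a \<otimes> id b)" for x
    using bil by (auto simp: cbilinear_def clinear_iff pure_tensor_linear)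
  have "clinear (\<lambda>x. tensor_map (amult A x) id t)" for t :: "('a, 'h) tensor"
    unfolding tensor_map_def
    by (rule clinear_tensor_lift_param[OF bl])
      (use bil in \<open>auto simp: cbilinear_def clinear_iff pure_tensor_linear\<close>)
  moreover have "clinear (\<lambda>a. tensor_map (amult A x) id (\<delta> a))" for x
    using clinear_tensor_map(1)[OF l[of x] i] lin unfolding clinear_iff by simp
  ultimately have "cbilinear (\<lambda>x a. tensor_map (amult A x) id (\<delta> a))"
    by (simp add: cbilinear_def)
  then show "clinear (pre_canonical_map A \<delta>)"
    "pre_canonical_map A \<delta> (x \<otimes> a) = tensor_map (amult A x) id (\<delta> a)"
    by (simp_all add: pre_canonical_map_def clinear_tensor_lift tensor_lift_pure)
qed

lemma canonical_map_coset:
  fixes H :: "('h::complex_vector, 'w) hopf_scheme" and A :: "('a::complex_vector, 'z) calgebra_scheme"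
  assumes com: "comodule_algebra H A \<delta>" and B: "B = coinvariants H \<delta>"
  shows "canonical_map A \<delta> (balanced_rel A B `` {t}) = pre_canonical_map A \<delta> t"
proof -
  note pre = pre_canonical_map_pure[OF com]
  have alg: "is_algebra A" and halg: "is_algebra H"
    using com by (auto simp: comodule_algebra_def hopf_algebra_def)
  have l: "clinear (amult A x)" for x
    using alg by (simp add: is_algebra_def cbilinear_def)
  have i: "clinear (id :: 'h \<Rightarrow> 'h)"
    by (simp add: clinear_iff)
  note tm = clinear_tensor_map[OF l i]
  have mult_pure: "tensor_mult A H (b \<otimes> aunit H) t = tensor_map (amult A b) id t" for b t
  proof -
    have bl: "cbilinear (\<lambda>a' b'. amult A a a' \<otimes> amult H h b')" for a h
      using alg halg
      by (auto simp: is_algebra_def clinear_iff cbilinear_def pure_tensor_linear)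
    define K where "K a h = tensor_lift (\<lambda>a' b'. amult A a a' \<otimes> amult H h b')" for a h
    have lin: "clinear (\<lambda>a. amult A a a' \<otimes> amult H h b')"
      "clinear (\<lambda>h. amult A a a' \<otimes> amult H h b')" for a a' h b'
      using alg halg
      by (simp_all add: is_algebra_def cbilinear_def clinear_iff pure_tensor_linear)
    have "clinear (\<lambda>a. K a h t)" for h t
      unfolding K_def by (rule clinear_tensor_lift_param[OF bl lin(1)])
    moreover have "clinear (\<lambda>h. K a h t)" for a t
      unfolding K_def by (rule clinear_tensor_lift_param[OF bl lin(2)])
    ultimately have "cbilinear (\<lambda>a h. K a h t)"
      by (simp add: cbilinear_def)
    then have "tensor_mult A H (b \<otimes> aunit H) t = K b (aunit H) t"
      unfolding tensor_mult_def K_def by (rule tensor_lift_pure)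
    then show ?thesis
      using halg by (simp add: K_def tensor_map_def is_algebra_def)
  qed
  have comp: "tensor_map (amult A x) id (tensor_map (amult A y) id t)
      = tensor_map (amult A (amult A x y)) id t" for x y and t :: "('a, 'h) tensor"
  proof (rule clinear_tensor_eqI[where f = "\<lambda>t. tensor_map (amult A x) id (tensor_map (amult A y) id t)"])
    show "clinear (\<lambda>t :: ('a, 'h) tensor. tensor_map (amult A x) id (tensor_map (amult A y) id t))"
      using tm(1)[of x] tm(1)[of y] unfolding clinear_iff by simp
    show "tensor_map (amult A x) id (tensor_map (amult A y) id (a \<otimes> b))
        = tensor_map (amult A (amult A x y)) id (a \<otimes> b)" for a and b :: 'h
      using alg by (simp add: tm(2) is_algebra_def)
  qed (rule tm(1))
  have add: "pre_canonical_map A \<delta> (u + v) = pre_canonical_map A \<delta> u + pre_canonical_map A \<delta> v"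
    and scale: "pre_canonical_map A \<delta> (c *\<^sub>C u) = c *\<^sub>C pre_canonical_map A \<delta> u" for u v c
    using pre(1) by (simp_all add: clinear_iff)
  have diff: "pre_canonical_map A \<delta> (u - v) = pre_canonical_map A \<delta> u - pre_canonical_map A \<delta> v" for u v
    using add[of "u - v" v] by (simp add: eq_diff_eq)
  have zero: "pre_canonical_map A \<delta> t = 0" if rel: "t \<in> balanced_relators A B" for t
  proof -
    obtain x b y where t: "t = amult A x b \<otimes> y - x \<otimes> amult A b y" and b: "b \<in> B"
      using rel unfolding balanced_relators_def by blast
    have "\<delta> (amult A b y) = tensor_map (amult A b) id (\<delta> y)"
      using b B com by (simp add: coinvariants_def comodule_algebra_def mult_pure)
    then have eq: "pre_canonical_map A \<delta> (amult A x b \<otimes> y)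
        = pre_canonical_map A \<delta> (x \<otimes> amult A b y)"
      by (simp add: pre comp)
    show ?thesis
      by (simp add: t diff eq)
  qed
  have "csubspace {t. pre_canonical_map A \<delta> t = 0}"
    using diff[of 0 0] by (auto simp: complex_vector.subspace_def add scale)
  then have span: "cspan (balanced_relators A B) \<subseteq> {t. pre_canonical_map A \<delta> t = 0}"
    using zero by (intro complex_vector.span_minimal) auto
  have "pre_canonical_map A \<delta> s = pre_canonical_map A \<delta> t" if "(t, s) \<in> balanced_rel A B" for s
  proof -
    have "pre_canonical_map A \<delta> (t - s) = 0"
      using that span by (auto simp: balanced_rel_def)
    then show ?thesis
      by (simp add: diff)
  qed
  moreover have "(t, t) \<in> balanced_rel A B"
    by (simp add: balanced_rel_def complex_vector.span_zero)
  ultimately have "pre_canonical_map A \<delta> ` (balanced_rel A B `` {t}) = {pre_canonical_map A \<delta> t}"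
    unfolding set_eq_iff image_iff Image_singleton_iff singleton_iff by blast
  then show ?thesis
    by (simp add: canonical_map_def)
qed

text \<open>By the preceding lemma the map on cosets is induced by a linear map, hence linear, so that
  it is an isomorphism iff it is bijective.\<close>

definition hopf_galois_extension ::
    "('h::complex_vector, 'w) hopf_scheme \<Rightarrow> ('a::complex_vector, 'z) calgebra_scheme
      \<Rightarrow> ('a \<Rightarrow> ('a, 'h) tensor) \<Rightarrow> 'a set \<Rightarrow> bool"
  where "hopf_galois_extension H A \<delta> B \<longleftrightarrow>
    comodule_algebra H A \<delta> \<and> B = coinvariants H \<delta> \<and>
    bij_betw (canonical_map A \<delta>) (balanced_tensor A B) UNIV"


section \<open>Bigradings and the deformed product\<close>

type_synonym 'n bidegree = "(int ^ 'n) \<times> (int ^ 'n)"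

definition is_decomposition ::
    "('i \<Rightarrow> 'a::complex_vector set) \<Rightarrow> 'a \<Rightarrow> ('i \<Rightarrow> 'a) \<Rightarrow> bool"
  where "is_decomposition G x f \<longleftrightarrow>
    finite {i. f i \<noteq> 0} \<and> (\<forall>i. f i \<in> G i) \<and> x = (\<Sum>i | f i \<noteq> 0. f i)"

definition direct_sum_decomposition :: "('i \<Rightarrow> 'a::complex_vector set) \<Rightarrow> bool"
  where "direct_sum_decomposition G \<longleftrightarrow>
    (\<forall>i. csubspace (G i)) \<and> (\<forall>x. \<exists>!f. is_decomposition G x f)"

definition component :: "('i \<Rightarrow> 'a::complex_vector set) \<Rightarrow> 'a \<Rightarrow> 'i \<Rightarrow> 'a"
  where "component G x = (THE f. is_decomposition G x f)"

definition graded_mult ::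
    "('a::complex_vector, 'z) calgebra_scheme \<Rightarrow> ('n::finite bidegree \<Rightarrow> 'a set) \<Rightarrow> bool"
  where "graded_mult A G \<longleftrightarrow>
    (\<forall>r s p q. \<forall>x\<in>G (r, s). \<forall>y\<in>G (p, q). amult A x y \<in> G (r + p, s + q))"

text \<open>The subspace \<open>\<Oplus>\<^sub>s G (r, s) \<otimes> G' (s, l)\<close>; its sum is direct when \<open>G\<close> and \<open>G'\<close> are
  direct sum decompositions.\<close>

definition graded_tensor ::
    "('n::finite bidegree \<Rightarrow> 'a::complex_vector set) \<Rightarrow> ('n bidegree \<Rightarrow> 'b::complex_vector set)
      \<Rightarrow> int ^ 'n \<Rightarrow> int ^ 'n \<Rightarrow> ('a, 'b) tensor set"
  where "graded_tensor G G' r l = cspan (\<Union>s. {x \<otimes> y | x y. x \<in> G (r, s) \<and> y \<in> G' (s, l)})"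

definition bigraded_hopf_algebra ::
    "('h::complex_vector, 'w) hopf_scheme \<Rightarrow> ('n::finite bidegree \<Rightarrow> 'h set) \<Rightarrow> bool"
  where "bigraded_hopf_algebra H G \<longleftrightarrow>
    hopf_algebra H \<and> direct_sum_decomposition G \<and> graded_mult H G \<and>
    (\<forall>r l. comult H ` G (r, l) \<subseteq> graded_tensor G G r l) \<and>
    (\<forall>r l. r \<noteq> l \<longrightarrow> (\<forall>h\<in>G (r, l). counit H h = 0)) \<and>
    (\<forall>r l. antipode H ` G (r, l) \<subseteq> G (- l, - r))"

definition bigraded_comodule_algebra ::
    "('h::complex_vector, 'w) hopf_scheme \<Rightarrow> ('n::finite bidegree \<Rightarrow> 'h set)
      \<Rightarrow> ('a::complex_vector, 'z) calgebra_scheme \<Rightarrow> ('n bidegree \<Rightarrow> 'a set)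
      \<Rightarrow> ('a \<Rightarrow> ('a, 'h) tensor) \<Rightarrow> bool"
  where "bigraded_comodule_algebra H GH A GA \<delta> \<longleftrightarrow>
    comodule_algebra H A \<delta> \<and> direct_sum_decomposition GA \<and> graded_mult A GA \<and>
    (\<forall>r l. \<delta> ` GA (r, l) \<subseteq> graded_tensor GA GH r l)"

definition real_vec :: "int ^ 'n \<Rightarrow> real ^ 'n"
  where "real_vec r = (\<chi> i. real_of_int (r $ i))"

definition phase :: "real ^ 'n ^ 'n \<Rightarrow> int ^ 'n::finite \<Rightarrow> int ^ 'n \<Rightarrow> complex"
  where "phase \<theta> r l = exp (of_real pi * \<i> * of_real ((\<theta> *v real_vec r) \<bullet> real_vec l))"

definition deformed_mult ::
    "real ^ 'n ^ 'n \<Rightarrow> ('n::finite bidegree \<Rightarrow> 'a::complex_vector set)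
      \<Rightarrow> ('a, 'z) calgebra_scheme \<Rightarrow> 'a \<Rightarrow> 'a \<Rightarrow> 'a"
  where "deformed_mult \<theta> G A x y =
    (\<Sum>(r1, r2) | component G x (r1, r2) \<noteq> 0. \<Sum>(l1, l2) | component G y (l1, l2) \<noteq> 0.
      (phase \<theta> r1 l1 * phase (- \<theta>) r2 l2)
        *\<^sub>C amult A (component G x (r1, r2)) (component G y (l1, l2)))"

lemma component_homogeneous:
  assumes "direct_sum_decomposition G" and "x \<in> G i"
  shows "component G x = (\<lambda>j. if j = i then x else 0)"
proof -
  have "is_decomposition G x (\<lambda>j. if j = i then x else 0)"
    using assms
    by (cases "x = 0")
      (auto simp: is_decomposition_def direct_sum_decomposition_def complex_vector.subspace_0)
  then show ?thesis
    unfolding component_def using assms(1)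
    by (intro the1_equality) (auto simp: direct_sum_decomposition_def)
qed

lemma deformed_mult_homogeneous:
  assumes A: "is_algebra A" and G: "direct_sum_decomposition G"
    and x: "x \<in> G (r1, r2)" and y: "y \<in> G (l1, l2)"
  shows "deformed_mult \<theta> G A x y = (phase \<theta> r1 l1 * phase (- \<theta>) r2 l2) *\<^sub>C amult A x y"
proof -
  have z: "amult A 0 y = 0" "amult A x 0 = 0"
    using A unfolding is_algebra_def cbilinear_def clinear_iff
    by (metis complex_vector.scale_zero_left)+
  have cx: "component G x = (\<lambda>j. if j = (r1, r2) then x else 0)"
    using G x by (rule component_homogeneous)
  have cy: "component G y = (\<lambda>j. if j = (l1, l2) then y else 0)"
    using G y by (rule component_homogeneous)
  show ?thesis
  proof (cases "x = 0 \<or> y = 0")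
    case True
    then show ?thesis
    proof
      assume "x = 0"
      then have "{i. component G x i \<noteq> 0} = {}"
        unfolding cx by simp
      then show ?thesis
        using \<open>x = 0\<close> z by (simp add: deformed_mult_def case_prod_unfold)
    next
      assume "y = 0"
      then have "{i. component G y i \<noteq> 0} = {}"
        unfolding cy by simp
      then show ?thesis
        using \<open>y = 0\<close> z by (simp add: deformed_mult_def case_prod_unfold)
    qed
  next
    case False
    then have "{i. component G x i \<noteq> 0} = {(r1, r2)}" "{i. component G y i \<noteq> 0} = {(l1, l2)}"
      by (auto simp: cx cy)
    then show ?thesis
      by (simp add: deformed_mult_def case_prod_unfold) (simp add: cx cy)
  qed
qed

text \<open>For a Hopf algebra this keeps unit, coproduct, counit and antipode.\<close>

definition deform ::
    "real ^ 'n ^ 'n \<Rightarrow> ('n::finite bidegree \<Rightarrow> 'a::complex_vector set)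
      \<Rightarrow> ('a, 'z) calgebra_scheme \<Rightarrow> ('a, 'z) calgebra_scheme"
  where "deform \<theta> G A = A\<lparr>amult := deformed_mult \<theta> G A\<rparr>"

end

theory Submission
  imports Defs
begin

text \<open>
  The phase \<open>phase \<theta> r l\<close> is bimultiplicative in \<open>(r, l)\<close>, so the deformed product twists the
  original one by a 2-cocycle on the group of bidegrees and is again associative, with the same
  unit because the unit has bidegree \<open>(0, 0)\<close> (\<open>is_algebra_deform\<close>, \<open>unit_degree_zero\<close>).

  The left degree is twisted by \<open>\<theta>\<close> and the right degree by \<open>-\<theta>\<close>.
  A coaction sends degree \<open>(r, l)\<close> to sums of \<open>x \<otimes> y\<close> with \<open>x\<close> of degree \<open>(r, s)\<close> and \<open>y\<close> of degree
  \<open>(s, l)\<close>.  When two such tensors are multiplied, the intermediate degrees contribute a phase to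
  the first factor and the inverse phase to the second.  What remains depends on the outer degrees
  alone and is exactly the phase of the deformed product before the coaction is applied.  Hence the
  coaction stays multiplicative (\<open>deformed_coaction_multiplicative\<close>); the coproduct is the case
  where a Hopf algebra coacts on itself.  The same cancellation makes the counit multiplicative, as
  it lives on degrees \<open>(r, r)\<close>.  In the antipode identities the intermediate degree is
  paired with itself, and skew-symmetry makes this phase trivial (\<open>hopf_algebra_deform\<close>).

  The equation \<open>\<delta> b = b \<otimes> 1\<close> involves only the coaction and the unit, which the deformation
  keeps, so the coinvariants form the same set.  They are closed under the deformed product
  because the coinvariants of any comodule algebra form a subalgebra.
\<close>

section \<open>Linear and bilinear maps\<close>

lemma clinear_add: "clinear f \<Longrightarrow> f (x + y) = f x + f y"
  and clinear_scale: "clinear f \<Longrightarrow> f (c *\<^sub>C x) = c *\<^sub>C f x"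
  by (simp_all add: clinear_iff)

lemma clinear_zero: "clinear f \<Longrightarrow> f 0 = 0"
  by (metis clinear_scale complex_vector.scale_zero_left)

lemma clinear_ident: "clinear (\<lambda>x. x)"
  by (simp add: clinear_iff)

lemma clinear_compose: "clinear f \<Longrightarrow> clinear g \<Longrightarrow> clinear (\<lambda>x. f (g x))"
  by (simp add: clinear_iff)

lemma clinear_scaled: "clinear f \<Longrightarrow> clinear (\<lambda>x. c *\<^sub>C f x)"
  by (simp add: clinear_iff scaleC_add_right scaleC_scaleC mult.commute)

lemma clinear_sum_maps:
  assumes "\<And>i. clinear (f i)"
  shows "clinear (\<lambda>x. \<Sum>i\<in>I. f i x)"
  using assms
  by (simp add: clinear_iff sum.distrib complex_vector.scale_sum_right)

lemma cbilinear_left: "cbilinear f \<Longrightarrow> clinear (\<lambda>x. f x y)"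
  and cbilinear_right: "cbilinear f \<Longrightarrow> clinear (f x)"
  by (simp_all add: cbilinear_def)

lemma cbilinearI: "(\<And>y. clinear (\<lambda>x. f x y)) \<Longrightarrow> (\<And>x. clinear (f x)) \<Longrightarrow> cbilinear f"
  by (simp add: cbilinear_def)

lemma cbilinear_compose:
  "cbilinear f \<Longrightarrow> clinear g \<Longrightarrow> clinear h \<Longrightarrow> cbilinear (\<lambda>x y. f (g x) (h y))"
  by (auto simp: cbilinear_def clinear_iff)

lemma cbilinear_after:
  "clinear g \<Longrightarrow> cbilinear f \<Longrightarrow> cbilinear (\<lambda>x y. g (f x y))"
  by (auto simp: cbilinear_def clinear_iff)

lemma cbilinear_scaled: "cbilinear f \<Longrightarrow> cbilinear (\<lambda>x y. c *\<^sub>C f x y)"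
  by (simp add: cbilinear_def clinear_scaled)

lemma cbilinear_tensor_mult:
  assumes A: "cbilinear (amult A)" and B: "cbilinear (amult B)"
  shows "cbilinear (tensor_mult A B)"
    and "tensor_mult A B (a \<otimes> b) (a' \<otimes> b') = amult A a a' \<otimes> amult B b b'"
proof -
  define K where "K a b = tensor_lift (\<lambda>a' b'. amult A a a' \<otimes> amult B b b')" for a b
  have bil: "cbilinear (\<lambda>a' b'. amult A a a' \<otimes> amult B b b')" for a b
    using A B by (auto simp: cbilinear_def clinear_iff pure_tensor_linear)
  have K: "clinear (K a b)" "K a b (a' \<otimes> b') = amult A a a' \<otimes> amult B b b'" for a b a' b'
    unfolding K_def using bil by (simp_all add: clinear_tensor_lift tensor_lift_pure)
  have K_left: "cbilinear (\<lambda>a b. K a b t)" for t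
  proof (rule cbilinearI)
    show "clinear (\<lambda>a. K a b t)" for b
      unfolding K_def
      by (rule clinear_tensor_lift_param[OF bil])
        (use A in \<open>simp add: cbilinear_def clinear_iff pure_tensor_linear\<close>)
    show "clinear (\<lambda>b. K a b t)" for a
      unfolding K_def
      by (rule clinear_tensor_lift_param[OF bil])
        (use B in \<open>simp add: cbilinear_def clinear_iff pure_tensor_linear\<close>)
  qed
  have eq: "tensor_mult A B s t = tensor_lift (\<lambda>a b. K a b t) s" for s t
    by (simp add: tensor_mult_def K_def)
  show "cbilinear (tensor_mult A B)"
  proof (rule cbilinearI)
    show "clinear (\<lambda>s. tensor_mult A B s t)" for t
      unfolding eq by (rule clinear_tensor_lift[OF K_left])
    show "clinear (tensor_mult A B s)" for s
      unfolding eq by (rule clinear_tensor_lift_param[OF K_left K(1)])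
  qed
  show "tensor_mult A B (a \<otimes> b) (a' \<otimes> b') = amult A a a' \<otimes> amult B b b'"
    unfolding eq tensor_lift_pure[OF K_left] by (rule K(2))
qed


section \<open>Reduction to homogeneous elements\<close>

lemma is_decomposition_component:
  assumes "direct_sum_decomposition G"
  shows "is_decomposition G x (component G x)"
  unfolding component_def
  by (rule theI'[of "is_decomposition G x"])
    (use assms in \<open>simp add: direct_sum_decomposition_def\<close>)

lemma component_eqI:
  assumes "direct_sum_decomposition G" and "is_decomposition G x f"
  shows "component G x = f"
  unfolding component_def
  by (rule the1_equality) (use assms in \<open>auto simp: direct_sum_decomposition_def\<close>)

lemma
  assumes G: "direct_sum_decomposition G"
  shows finite_component_support: "finite {i. component G x i \<noteq> 0}"
    and component_mem: "component G x i \<in> G i"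
    and sum_components: "(\<Sum>i | component G x i \<noteq> 0. component G x i) = x"
  using is_decomposition_component[OF G, of x] by (auto simp: is_decomposition_def)

lemma sum_over_component_support:
  assumes "finite S" and "{i. component G x i \<noteq> 0} \<subseteq> S" and "\<And>i. F i 0 = 0"
  shows "(\<Sum>i | component G x i \<noteq> 0. F i (component G x i)) = (\<Sum>i\<in>S. F i (component G x i))"
  using assms by (intro sum.mono_neutral_left) auto

lemma clinear_component:
  assumes G: "direct_sum_decomposition G"
  shows "clinear (\<lambda>x. component G x i)"
proof -
  have sub: "csubspace (G i)" for i
    using G by (simp add: direct_sum_decomposition_def)
  note fin = finite_component_support[OF G]
  note total = sum_over_component_support[where F = "\<lambda>i x. x"]
  have "component G (x + y) = (\<lambda>i. component G x i + component G y i)" for x y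
  proof (rule component_eqI[OF G])
    let ?f = "\<lambda>i. component G x i + component G y i"
    let ?S = "{i. component G x i \<noteq> 0} \<union> {i. component G y i \<noteq> 0}"
    have S: "finite ?S" and supp: "{i. ?f i \<noteq> 0} \<subseteq> ?S"
      using fin by auto
    have "(\<Sum>i | ?f i \<noteq> 0. ?f i) = (\<Sum>i\<in>?S. ?f i)"
      by (rule sum.mono_neutral_left[OF S supp]) auto
    also have "\<dots> = x + y"
      using total[OF S, of G x] total[OF S, of G y] sum_components[OF G]
      by (simp add: sum.distrib)
    finally show "is_decomposition G (x + y) ?f"
      using finite_subset[OF supp S] component_mem[OF G] sub
      by (simp add: is_decomposition_def complex_vector.subspace_add)
  qed
  moreover have "component G (c *\<^sub>C x) = (\<lambda>i. c *\<^sub>C component G x i)" for c x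
  proof (rule component_eqI[OF G])
    let ?f = "\<lambda>i. c *\<^sub>C component G x i"
    let ?S = "{i. component G x i \<noteq> 0}"
    have supp: "{i. ?f i \<noteq> 0} \<subseteq> ?S"
      by auto
    have "(\<Sum>i | ?f i \<noteq> 0. ?f i) = (\<Sum>i\<in>?S. ?f i)"
      by (rule sum.mono_neutral_left[OF fin supp]) auto
    also have "\<dots> = c *\<^sub>C x"
      by (simp add: complex_vector.scale_sum_right[symmetric] sum_components[OF G])
    finally show "is_decomposition G (c *\<^sub>C x) ?f"
      using finite_subset[OF supp fin] component_mem[OF G] sub
      by (simp add: is_decomposition_def complex_vector.subspace_scale)
  qed
  ultimately show ?thesis
    by (simp add: clinear_iff)
qed

text \<open>The index set of the sum varies with the element; as every \<open>F i\<close> kills zero, it can be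
  enlarged to the union of the supports of the elements to be compared.\<close>

lemma clinear_sum_components:
  assumes G: "direct_sum_decomposition G" and F: "\<And>i. clinear (F i)"
  shows "clinear (\<lambda>x. \<Sum>i | component G x i \<noteq> 0. F i (component G x i))"
  unfolding clinear_iff
proof (intro conjI allI)
  fix x y c
  let ?supp = "\<lambda>x. {i. component G x i \<noteq> 0}"
  let ?S = "?supp x \<union> ?supp y \<union> ?supp (x + y) \<union> ?supp (c *\<^sub>C x)"
  have S: "finite ?S"
    using finite_component_support[OF G] by blast
  have expand: "(\<Sum>i\<in>?supp z. F i (component G z i)) = (\<Sum>i\<in>?S. F i (component G z i))"
    if "?supp z \<subseteq> ?S" for z
    using S that clinear_zero[OF F] by (rule sum_over_component_support)
  have "(\<Sum>i\<in>?S. F i (component G (x + y) i))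
      = (\<Sum>i\<in>?S. F i (component G x i)) + (\<Sum>i\<in>?S. F i (component G y i))"
    by (simp only: clinear_add[OF clinear_component[OF G]] clinear_add[OF F] sum.distrib)
  moreover have "(\<Sum>i\<in>?S. F i (component G (c *\<^sub>C x) i)) = c *\<^sub>C (\<Sum>i\<in>?S. F i (component G x i))"
    by (simp only: clinear_scale[OF clinear_component[OF G]] clinear_scale[OF F]
        complex_vector.scale_sum_right)
  moreover have "?supp x \<subseteq> ?S" "?supp y \<subseteq> ?S" "?supp (x + y) \<subseteq> ?S" "?supp (c *\<^sub>C x) \<subseteq> ?S"
    by blast+
  ultimately show
    "(\<Sum>i\<in>?supp (x + y). F i (component G (x + y) i))
      = (\<Sum>i\<in>?supp x. F i (component G x i)) + (\<Sum>i\<in>?supp y. F i (component G y i))"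
    "(\<Sum>i\<in>?supp (c *\<^sub>C x). F i (component G (c *\<^sub>C x) i)) = c *\<^sub>C (\<Sum>i\<in>?supp x. F i (component G x i))"
    by (simp_all only: expand)
qed

lemma clinear_eq_homogeneous:
  assumes G: "direct_sum_decomposition G" and f: "clinear f" and g: "clinear g"
    and eq: "\<And>i x. x \<in> G i \<Longrightarrow> f x = g x"
  shows "f x = g x"
proof -
  have "f (\<Sum>i\<in>S. component G x i) = g (\<Sum>i\<in>S. component G x i)" if "finite S" for S
    using that
    by (induction S)
      (simp_all add: clinear_zero[OF f] clinear_zero[OF g] clinear_add[OF f] clinear_add[OF g]
        eq[OF component_mem[OF G]])
  from this[OF finite_component_support[OF G, of x]] show ?thesis
    by (simp only: sum_components[OF G])
qed

lemma cbilinear_eq_homogeneous: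
  assumes G: "direct_sum_decomposition G" and G': "direct_sum_decomposition G'"
    and f: "cbilinear f" and g: "cbilinear g"
    and eq: "\<And>i j x y. x \<in> G i \<Longrightarrow> y \<in> G' j \<Longrightarrow> f x y = g x y"
  shows "f x y = g x y"
proof (rule clinear_eq_homogeneous[OF G])
  show "clinear (\<lambda>x. f x y)" "clinear (\<lambda>x. g x y)"
    using f g by (simp_all add: cbilinear_left)
  show "f x y = g x y" if "x \<in> G i" for x i
    using eq[OF that]
    by (rule clinear_eq_homogeneous[OF G' cbilinear_right[OF f] cbilinear_right[OF g]])
qed

text \<open>The set where two linear maps agree is a subspace, so it suffices to compare them on the pure
  tensors of matching intermediate degree, which span.\<close>

lemma clinear_eq_graded_tensor:
  assumes f: "clinear f" and g: "clinear g"
    and eq: "\<And>s x y. x \<in> G (r, s) \<Longrightarrow> y \<in> G' (s, l) \<Longrightarrow> f (x \<otimes> y) = g (x \<otimes> y)"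
    and t: "t \<in> graded_tensor G G' r l"
  shows "f t = g t"
proof -
  have "csubspace {t. f t = g t}"
    using f g
    by (simp add: complex_vector.subspace_def clinear_zero clinear_add clinear_scale)
  then have "graded_tensor G G' r l \<subseteq> {t. f t = g t}"
    unfolding graded_tensor_def
    by (intro complex_vector.span_minimal) (use eq in auto)
  with t show ?thesis
    by blast
qed

lemma cbilinear_eq_graded_tensor:
  assumes f: "cbilinear f" and g: "cbilinear g"
    and eq: "\<And>s t x y x' y'. x \<in> G (r, s) \<Longrightarrow> y \<in> G' (s, l) \<Longrightarrow> x' \<in> G (p, t) \<Longrightarrow> y' \<in> G' (t, q)
      \<Longrightarrow> f (x \<otimes> y) (x' \<otimes> y') = g (x \<otimes> y) (x' \<otimes> y')"
    and u: "u \<in> graded_tensor G G' r l" and v: "v \<in> graded_tensor G G' p q"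
  shows "f u v = g u v"
proof (rule clinear_eq_graded_tensor[OF _ _ _ u])
  show "clinear (\<lambda>u. f u v)" "clinear (\<lambda>u. g u v)"
    using f g by (simp_all add: cbilinear_left)
  show "f (x \<otimes> y) v = g (x \<otimes> y) v" if "x \<in> G (r, s)" "y \<in> G' (s, l)" for s x y
    using eq[OF that]
    by (rule clinear_eq_graded_tensor[OF cbilinear_right[OF f] cbilinear_right[OF g] _ v])
qed


section \<open>The phase as a bicharacter\<close>

lemma real_vec_add: "real_vec (r + p) = real_vec r + real_vec p"
  and real_vec_minus: "real_vec (- r) = - real_vec r"
  and real_vec_zero: "real_vec 0 = 0"
  by (simp_all add: real_vec_def vec_eq_iff)

lemma phase_add_left: "phase \<theta> (r + p) l = phase \<theta> r l * phase \<theta> p l"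
  by (simp add: phase_def real_vec_add matrix_vector_right_distrib inner_add_left
      exp_add[symmetric] algebra_simps)

lemma phase_add_right: "phase \<theta> r (l + m) = phase \<theta> r l * phase \<theta> r m"
  by (simp add: phase_def real_vec_add inner_add_right exp_add[symmetric] algebra_simps)

lemma phase_zero [simp]: "phase \<theta> 0 l = 1" "phase \<theta> r 0 = 1"
  by (simp_all add: phase_def real_vec_zero)

lemma phase_minus_matrix: "phase (- \<theta>) r l = inverse (phase \<theta> r l)"
proof -
  have "(- \<theta>) *v x = - (\<theta> *v x)" for x
    by (simp add: vec_eq_iff matrix_vector_mult_def sum_negf)
  then show ?thesis
    by (simp add: phase_def exp_minus)
qed

lemma phase_nonzero [simp]: "phase \<theta> r l \<noteq> 0"
  by (simp add: phase_def)

lemma phase_minus_left: "phase \<theta> (- r) l = inverse (phase \<theta> r l)"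
  using phase_add_left[of \<theta> "- r" r l] by (simp add: field_simps)

lemma phase_minus_right: "phase \<theta> r (- l) = inverse (phase \<theta> r l)"
  using phase_add_right[of \<theta> r "- l" l] by (simp add: field_simps)

text \<open>The quadratic form of a skew-symmetric matrix vanishes.\<close>

lemma phase_diagonal:
  assumes "transpose \<theta> = - \<theta>"
  shows "phase \<theta> r r = 1"
proof -
  let ?v = "real_vec r"
  have "(\<theta> *v ?v) \<bullet> ?v = ?v \<bullet> (transpose \<theta> *v ?v)"
    by (metis dot_lmul_matrix inner_commute vector_transpose_matrix transpose_matrix_vector)
  also have "\<dots> = - (?v \<bullet> (\<theta> *v ?v))"
    unfolding assms
    by (simp add: inner_vec_def matrix_vector_mult_def sum_negf)
  finally have "(\<theta> *v ?v) \<bullet> ?v = 0"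
    by (simp add: inner_commute)
  then show ?thesis
    by (simp add: phase_def)
qed


section \<open>The deformed algebra\<close>

lemma deform_simps [simp]:
  "amult (deform \<theta> G A) = deformed_mult \<theta> G A" "aunit (deform \<theta> G A) = aunit A"
  by (simp_all add: deform_def)

lemma deform_hopf_simps [simp]:
  "comult (deform \<theta> G H) = comult H" "counit (deform \<theta> G H) = counit H"
  "antipode (deform \<theta> G H) = antipode H"
  by (simp_all add: deform_def)

text \<open>Both sums in the deformed product run over supports that depend on the arguments, so
  linearity in each argument is an instance of \<open>clinear_sum_components\<close>.\<close>

lemma cbilinear_deformed_mult:
  assumes A: "cbilinear (amult A)" and G: "direct_sum_decomposition G"
  shows "cbilinear (deformed_mult \<theta> G A)"
proof (rule cbilinearI)
  let ?c = "\<lambda>i j. phase \<theta> (fst i) (fst j) * phase (- \<theta>) (snd i) (snd j)"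
  have expand: "deformed_mult \<theta> G A x y = (\<Sum>i | component G x i \<noteq> 0. \<Sum>j | component G y j \<noteq> 0.
      ?c i j *\<^sub>C amult A (component G x i) (component G y j))" for x y
    by (simp add: deformed_mult_def case_prod_unfold)
  show "clinear (\<lambda>x. deformed_mult \<theta> G A x y)" for y
    unfolding expand
    by (rule clinear_sum_components[OF G,
          where F = "\<lambda>i z. \<Sum>j | component G y j \<noteq> 0. ?c i j *\<^sub>C amult A z (component G y j)"])
      (intro clinear_sum_maps clinear_scaled cbilinear_left[OF A])
  show "clinear (deformed_mult \<theta> G A x)" for x
    unfolding expand
    by (intro clinear_sum_maps clinear_sum_components[OF G,
          where F = "\<lambda>j z. ?c _ j *\<^sub>C amult A (component G x _) z"]
        clinear_scaled cbilinear_right[OF A])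
qed

text \<open>In the decomposition of the unit, the part of degree zero already acts as a left unit:
  for homogeneous \<open>x\<close>, the summands \<open>1\<^sub>i x\<close> of \<open>1 x = x\<close> lie in distinct degrees, and only the one
  with \<open>i = 0\<close> lies in the degree of \<open>x\<close>.  A left unit equals the unit.\<close>

lemma unit_degree_zero:
  fixes G :: "'n::finite bidegree \<Rightarrow> 'a::complex_vector set"
  assumes A: "is_algebra A" and G: "direct_sum_decomposition G" and mult: "graded_mult A G"
  shows "aunit A \<in> G (0, 0)"
proof -
  have bil: "cbilinear (amult A)" and unit: "amult A (aunit A) x = x" "amult A x (aunit A) = x" for x
    using A by (simp_all add: is_algebra_def)
  define e where "e = component G (aunit A)"
  have deg: "e i \<in> G i" for i
    unfolding e_def by (rule component_mem[OF G])
  have "amult A (e (0, 0)) x = x" for x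
  proof (rule clinear_eq_homogeneous[OF G cbilinear_right[OF bil] clinear_ident])
    fix j :: "'n bidegree" and x
    assume x: "x \<in> G j"
    \<comment> \<open>Compare the parts of degree \<open>j\<close> in the expansion of \<open>1 x = x\<close>.\<close>
    have comp: "component G (amult A (e i) x) j = (if i = (0, 0) then amult A (e i) x else 0)" for i
    proof -
      have "amult A (e i) x \<in> G (fst i + fst j, snd i + snd j)"
        using mult deg[of i] x unfolding graded_mult_def by (metis prod.collapse)
      moreover have "(fst i + fst j, snd i + snd j) = j \<longleftrightarrow> i = (0, 0)"
        by (cases i; cases j) simp
      ultimately show ?thesis
        using component_homogeneous[OF G] by fastforce
    qed
    let ?f = "\<lambda>z. component G (amult A z x) j"
    have f: "clinear ?f"
      by (rule clinear_compose[OF clinear_component[OF G] cbilinear_left[OF bil]])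
    let ?S = "{i. e i \<noteq> 0}"
    have S: "finite ?S" and sum_e: "(\<Sum>i\<in>?S. e i) = aunit A"
      unfolding e_def by (rule finite_component_support[OF G], rule sum_components[OF G])
    have f_sum: "?f (\<Sum>i\<in>T. e i) = (\<Sum>i\<in>T. ?f (e i))" if "finite T" for T
      using that by (induction T) (simp_all add: clinear_zero[OF f] clinear_add[OF f])
    have "x = ?f (\<Sum>i\<in>?S. e i)"
      using component_homogeneous[OF G x] by (simp add: sum_e unit)
    also have "\<dots> = (\<Sum>i\<in>?S. if i = (0, 0) then amult A (e i) x else 0)"
      by (simp only: f_sum[OF S] comp)
    also have "\<dots> = amult A (e (0, 0)) x"
      using S by (simp add: clinear_zero[OF cbilinear_left[OF bil]])
    finally show "amult A (e (0, 0)) x = x" ..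
  qed
  then have "e (0, 0) = aunit A"
    using unit by metis
  then show ?thesis
    using deg by metis
qed

text \<open>On homogeneous elements, both bracketings of a triple product carry the phases of the three
  pairs of factors, by bimultiplicativity; on a pair with the unit the phase is that of degree
  zero.\<close>

lemma is_algebra_deform:
  assumes A: "is_algebra A" and G: "direct_sum_decomposition G" and mult: "graded_mult A G"
  shows "is_algebra (deform \<theta> G A)"
proof -
  let ?m = "deformed_mult \<theta> G A"
  have bil: "cbilinear (amult A)" and assoc: "amult A (amult A x y) z = amult A x (amult A y z)"
    and unit: "amult A (aunit A) x = x" "amult A x (aunit A) = x" for x y z
    using A by (simp_all add: is_algebra_def)
  note hom = deformed_mult_homogeneous[OF A G, of _ _ _ _ _ _ \<theta>]
  note deg = mult[unfolded graded_mult_def, rule_format]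
  have m: "cbilinear ?m"
    by (rule cbilinear_deformed_mult[OF bil G])
  note left = cbilinear_left[OF m] and right = cbilinear_right[OF m]
  have assoc_hom: "?m (?m x y) z = ?m x (?m y z)"
    if x: "x \<in> G i" and y: "y \<in> G j" and z: "z \<in> G k" for x y z i j k
  proof -
    obtain r1 r2 l1 l2 m1 m2 where ijk: "i = (r1, r2)" "j = (l1, l2)" "k = (m1, m2)"
      by (cases i, cases j, cases k)
    note xyz = x[unfolded ijk] y[unfolded ijk] z[unfolded ijk]
    show ?thesis
      by (simp add: hom[OF xyz(1,2)] hom[OF xyz(2,3)] clinear_scale[OF left] clinear_scale[OF right]
          hom[OF deg[OF xyz(1,2)] xyz(3)] hom[OF xyz(1) deg[OF xyz(2,3)]]
          scaleC_scaleC assoc phase_add_left phase_add_right mult_ac)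
  qed
  have "?m (?m x y) z = ?m x (?m y z)" for x y z
  proof (rule clinear_eq_homogeneous[OF G, where x = x])
    show "clinear (\<lambda>x. ?m (?m x y) z)" "clinear (\<lambda>x. ?m x (?m y z))"
      by (intro left clinear_compose[OF left left])+
    show "?m (?m x y) z = ?m x (?m y z)" if x: "x \<in> G i" for x i
      by (rule cbilinear_eq_homogeneous[OF G G _ _ assoc_hom[OF x]])
        (intro cbilinearI clinear_compose[OF left] clinear_compose[OF right] left right)+
  qed
  moreover have "?m (aunit A) x = x" for x
    by (rule clinear_eq_homogeneous[OF G right clinear_ident])
      (auto simp: hom[OF unit_degree_zero[OF A G mult]] unit scaleC_one)
  moreover have "?m x (aunit A) = x" for x
    by (rule clinear_eq_homogeneous[OF G left clinear_ident])
      (auto simp: hom[OF _ unit_degree_zero[OF A G mult]] unit scaleC_one)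
  ultimately show ?thesis
    using m by (simp add: is_algebra_def)
qed


section \<open>Coactions, Hopf structure and coinvariants\<close>

text \<open>For \<open>x \<otimes> y\<close> of degrees \<open>(r, s)\<close>, \<open>(s, l)\<close> and \<open>x' \<otimes> y'\<close> of degrees \<open>(p, t)\<close>, \<open>(t, q)\<close>, the
  product in the first factor has phase \<open>\<lambda>\<^sub>\<theta>(r,p) \<lambda>\<^sub>-\<^sub>\<theta>(s,t)\<close> and the one in the second factor has
  \<open>\<lambda>\<^sub>\<theta>(s,t) \<lambda>\<^sub>-\<^sub>\<theta>(l,q)\<close>.  The total \<open>\<lambda>\<^sub>\<theta>(r,p) \<lambda>\<^sub>-\<^sub>\<theta>(l,q)\<close> is the same for all \<open>s\<close> and \<open>t\<close>,
  so it can be taken out of the sums.  The coproduct is covered by taking \<open>A = H\<close>.\<close>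

lemma deformed_coaction_multiplicative:
  assumes A: "is_algebra A" and H: "is_algebra H"
    and GA: "direct_sum_decomposition GA" and GH: "direct_sum_decomposition GH"
    and \<delta>: "clinear \<delta>" and mult: "\<And>a b. \<delta> (amult A a b) = tensor_mult A H (\<delta> a) (\<delta> b)"
    and graded: "\<And>r l. \<delta> ` GA (r, l) \<subseteq> graded_tensor GA GH r l"
  shows "\<delta> (deformed_mult \<theta> GA A a b)
    = tensor_mult (deform \<theta> GA A) (deform \<theta> GH H) (\<delta> a) (\<delta> b)"
proof (rule cbilinear_eq_homogeneous[OF GA GA])
  have bA: "cbilinear (amult A)" and bH: "cbilinear (amult H)"
    using A H by (simp_all add: is_algebra_def)
  have dA: "cbilinear (amult (deform \<theta> GA A))" and dH: "cbilinear (amult (deform \<theta> GH H))"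
    by (simp_all add: cbilinear_deformed_mult bA bH GA GH)
  show "cbilinear (\<lambda>a b. \<delta> (deformed_mult \<theta> GA A a b))"
    by (rule cbilinear_after[OF \<delta> cbilinear_deformed_mult[OF bA GA]])
  show "cbilinear (\<lambda>a b. tensor_mult (deform \<theta> GA A) (deform \<theta> GH H) (\<delta> a) (\<delta> b))"
    by (rule cbilinear_compose[OF cbilinear_tensor_mult(1)[OF dA dH] \<delta> \<delta>])
  fix i j a b
  assume ab: "a \<in> GA i" "b \<in> GA j"
  obtain r l p q where ij: "i = (r, l)" "j = (p, q)"
    by (cases i, cases j)
  let ?c = "phase \<theta> r p * phase (- \<theta>) l q"
  have in_tensor: "\<delta> a \<in> graded_tensor GA GH r l" "\<delta> b \<in> graded_tensor GA GH p q"
    using ab graded unfolding ij by blast+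
  have "tensor_mult (deform \<theta> GA A) (deform \<theta> GH H) (\<delta> a) (\<delta> b)
      = ?c *\<^sub>C tensor_mult A H (\<delta> a) (\<delta> b)"
  proof (rule cbilinear_eq_graded_tensor[OF cbilinear_tensor_mult(1)[OF dA dH]
        cbilinear_scaled[OF cbilinear_tensor_mult(1)[OF bA bH]] _ in_tensor])
    fix s t x y x' y'
    assume x: "x \<in> GA (r, s)" "x' \<in> GA (p, t)" and y: "y \<in> GH (s, l)" "y' \<in> GH (t, q)"
    show "tensor_mult (deform \<theta> GA A) (deform \<theta> GH H) (x \<otimes> y) (x' \<otimes> y')
        = ?c *\<^sub>C tensor_mult A H (x \<otimes> y) (x' \<otimes> y')"
      by (simp add: cbilinear_tensor_mult(2)[OF dA dH] cbilinear_tensor_mult(2)[OF bA bH]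
          deformed_mult_homogeneous[OF A GA x] deformed_mult_homogeneous[OF H GH y]
          pure_tensor_linear scaleC_scaleC phase_minus_matrix)
  qed
  then show "\<delta> (deformed_mult \<theta> GA A a b)
      = tensor_mult (deform \<theta> GA A) (deform \<theta> GH H) (\<delta> a) (\<delta> b)"
    by (simp add: deformed_mult_homogeneous[OF A GA ab[unfolded ij]] clinear_scale[OF \<delta>] mult)
qed

text \<open>If both factors have diagonal degrees \<open>(r, r)\<close> and \<open>(p, p)\<close>, the phase
  \<open>\<lambda>\<^sub>\<theta>(r,p) \<lambda>\<^sub>-\<^sub>\<theta>(r,p)\<close> is one; otherwise both sides vanish.\<close>

lemma deformed_counit_multiplicative:
  assumes H: "is_algebra H" and G: "direct_sum_decomposition G"
    and \<epsilon>: "clinear \<epsilon>" and mult: "\<And>g h. \<epsilon> (amult H g h) = \<epsilon> g * \<epsilon> h"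
    and diag: "\<And>r l h. r \<noteq> l \<Longrightarrow> h \<in> G (r, l) \<Longrightarrow> \<epsilon> h = 0"
  shows "\<epsilon> (deformed_mult \<theta> G H g h) = \<epsilon> g * (\<epsilon> h :: complex)"
proof (rule cbilinear_eq_homogeneous[OF G G])
  have bH: "cbilinear (amult H)"
    using H by (simp add: is_algebra_def)
  show "cbilinear (\<lambda>g h. \<epsilon> (deformed_mult \<theta> G H g h))"
    by (rule cbilinear_after[OF \<epsilon> cbilinear_deformed_mult[OF bH G]])
  show "cbilinear (\<lambda>g h. \<epsilon> g * \<epsilon> h)"
    using \<epsilon> by (auto simp: cbilinear_def clinear_iff scaleC_complex_def algebra_simps)
  fix i j g h
  assume gh: "g \<in> G i" "h \<in> G j"
  obtain r l p q where ij: "i = (r, l)" "j = (p, q)"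
    by (cases i, cases j)
  note gh = gh[unfolded ij]
  have "\<epsilon> (deformed_mult \<theta> G H g h) = phase \<theta> r p * phase (- \<theta>) l q * (\<epsilon> g * \<epsilon> h)"
    by (simp add: deformed_mult_homogeneous[OF H G gh] clinear_scale[OF \<epsilon>] mult scaleC_complex_def)
  also have "\<dots> = \<epsilon> g * \<epsilon> h"
    using diag[OF _ gh(1)] diag[OF _ gh(2)]
    by (cases "r = l"; cases "p = q") (simp_all add: phase_minus_matrix)
  finally show "\<epsilon> (deformed_mult \<theta> G H g h) = \<epsilon> g * \<epsilon> h" .
qed

text \<open>For the antipode, let \<open>a \<otimes> b\<close> have degrees \<open>(r, s)\<close> and \<open>(s, l)\<close>.  Then \<open>S a\<close> has degree
  \<open>(-s, -r)\<close>, so the deformed product of \<open>S a\<close> and \<open>b\<close> has phase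
  \<open>\<lambda>\<^sub>\<theta>(-s,s) \<lambda>\<^sub>-\<^sub>\<theta>(-r,l)\<close>, which equals \<open>\<lambda>\<^sub>\<theta>(r,l)\<close> by skew-symmetry.  This factor is independent of
  \<open>s\<close> and leaves \<open>\<lambda>\<^sub>\<theta>(r,l) \<epsilon>(h) 1\<close>, where the phase may be dropped: \<open>\<epsilon>(h)\<close> vanishes for
  \<open>r \<noteq> l\<close>, and the phase is trivial for \<open>r = l\<close>.  The other identity works alike, with
  \<open>\<lambda>\<^sub>-\<^sub>\<theta>(r,l)\<close>.\<close>

lemma hopf_algebra_deform:
  assumes H: "bigraded_hopf_algebra H G" and \<theta>: "transpose \<theta> = - \<theta>"
  shows "hopf_algebra (deform \<theta> G H)"
proof -
  have hopf: "hopf_algebra H" and G: "direct_sum_decomposition G" and gr: "graded_mult H G"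
    and comult_gr: "\<And>r l. comult H ` G (r, l) \<subseteq> graded_tensor G G r l"
    and diag: "\<And>r l h. r \<noteq> l \<Longrightarrow> h \<in> G (r, l) \<Longrightarrow> counit H h = 0"
    and anti_gr: "\<And>r l. antipode H ` G (r, l) \<subseteq> G (- l, - r)"
    using H by (auto simp: bigraded_hopf_algebra_def)
  have alg: "is_algebra H" and bil: "cbilinear (amult H)"
    and \<Delta>: "clinear (comult H)" and \<epsilon>: "clinear (counit H)" and S: "clinear (antipode H)"
    using hopf by (auto simp: hopf_algebra_def is_algebra_def)
  have anti: "tensor_lift (\<lambda>a b. amult H (antipode H a) b) (comult H h) = counit H h *\<^sub>C aunit H"
    "tensor_lift (\<lambda>a b. amult H a (antipode H b)) (comult H h) = counit H h *\<^sub>C aunit H" for h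
    using hopf by (simp_all add: hopf_algebra_def)
  let ?m = "deformed_mult \<theta> G H"
  have m: "cbilinear ?m"
    by (rule cbilinear_deformed_mult[OF bil G])
  note SL = cbilinear_compose[OF _ S clinear_ident]
  note SR = cbilinear_compose[OF _ clinear_ident S]
  have target: "clinear (\<lambda>h. counit H h *\<^sub>C aunit H)"
    using \<epsilon> by (simp add: clinear_iff scaleC_add_left scaleC_scaleC scaleC_complex_def)
  \<comment> \<open>The phases by which the deformed antipode identities differ from the original ones are
    invisible after multiplication by the counit.\<close>
  have phase_counit: "phase \<theta> r l *\<^sub>C (counit H h *\<^sub>C aunit H) = counit H h *\<^sub>C aunit H"
    "phase (- \<theta>) r l *\<^sub>C (counit H h *\<^sub>C aunit H) = counit H h *\<^sub>C aunit H"
    if "h \<in> G (r, l)" for r l h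
    using that diag[of r l h]
    by (cases "r = l"; simp add: phase_minus_matrix phase_diagonal[OF \<theta>] scaleC_one)+
  have "tensor_lift (\<lambda>a b. ?m (antipode H a) b) (comult H h) = counit H h *\<^sub>C aunit H" for h
  proof (rule clinear_eq_homogeneous[OF G _ target])
    show "clinear (\<lambda>h. tensor_lift (\<lambda>a b. ?m (antipode H a) b) (comult H h))"
      by (rule clinear_compose[OF clinear_tensor_lift[OF SL[OF m]] \<Delta>])
    fix i h assume h: "h \<in> G i"
    obtain r l where i: "i = (r, l)" by (cases i)
    have "comult H h \<in> graded_tensor G G r l"
      using h comult_gr unfolding i by blast
    then have "tensor_lift (\<lambda>a b. ?m (antipode H a) b) (comult H h)
        = phase \<theta> r l *\<^sub>C tensor_lift (\<lambda>a b. amult H (antipode H a) b) (comult H h)"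
    proof (rule clinear_eq_graded_tensor[OF clinear_tensor_lift[OF SL[OF m]]
          clinear_scaled[OF clinear_tensor_lift[OF SL[OF bil]]], rotated])
      fix s a b assume a: "a \<in> G (r, s)" and b: "b \<in> G (s, l)"
      have Sa: "antipode H a \<in> G (- s, - r)"
        using a anti_gr by blast
      show "tensor_lift (\<lambda>a b. ?m (antipode H a) b) (a \<otimes> b)
          = phase \<theta> r l *\<^sub>C tensor_lift (\<lambda>a b. amult H (antipode H a) b) (a \<otimes> b)"
        by (simp add: tensor_lift_pure[OF SL[OF m]] tensor_lift_pure[OF SL[OF bil]]
            deformed_mult_homogeneous[OF alg G Sa b] phase_minus_left phase_minus_matrix
            phase_diagonal[OF \<theta>])
    qed
    then show "tensor_lift (\<lambda>a b. ?m (antipode H a) b) (comult H h) = counit H h *\<^sub>C aunit H"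
      by (simp only: anti phase_counit[OF h[unfolded i]])
  qed
  moreover have "tensor_lift (\<lambda>a b. ?m a (antipode H b)) (comult H h) = counit H h *\<^sub>C aunit H" for h
  proof (rule clinear_eq_homogeneous[OF G _ target])
    show "clinear (\<lambda>h. tensor_lift (\<lambda>a b. ?m a (antipode H b)) (comult H h))"
      by (rule clinear_compose[OF clinear_tensor_lift[OF SR[OF m]] \<Delta>])
    fix i h assume h: "h \<in> G i"
    obtain r l where i: "i = (r, l)" by (cases i)
    have "comult H h \<in> graded_tensor G G r l"
      using h comult_gr unfolding i by blast
    then have "tensor_lift (\<lambda>a b. ?m a (antipode H b)) (comult H h)
        = phase (- \<theta>) r l *\<^sub>C tensor_lift (\<lambda>a b. amult H a (antipode H b)) (comult H h)"
    proof (rule clinear_eq_graded_tensor[OF clinear_tensor_lift[OF SR[OF m]]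
          clinear_scaled[OF clinear_tensor_lift[OF SR[OF bil]]], rotated])
      fix s a b assume a: "a \<in> G (r, s)" and b: "b \<in> G (s, l)"
      have Sb: "antipode H b \<in> G (- l, - s)"
        using b anti_gr by blast
      show "tensor_lift (\<lambda>a b. ?m a (antipode H b)) (a \<otimes> b)
          = phase (- \<theta>) r l *\<^sub>C tensor_lift (\<lambda>a b. amult H a (antipode H b)) (a \<otimes> b)"
        by (simp add: tensor_lift_pure[OF SR[OF m]] tensor_lift_pure[OF SR[OF bil]]
            deformed_mult_homogeneous[OF alg G a Sb] phase_minus_right phase_minus_matrix
            phase_diagonal[OF \<theta>])
    qed
    then show "tensor_lift (\<lambda>a b. ?m a (antipode H b)) (comult H h) = counit H h *\<^sub>C aunit H"
      by (simp only: anti phase_counit[OF h[unfolded i]])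
  qed
  moreover have "comult H (?m g h) = tensor_mult (deform \<theta> G H) (deform \<theta> G H) (comult H g) (comult H h)"
    for g h
    by (rule deformed_coaction_multiplicative[OF alg alg G G \<Delta> _ comult_gr])
      (use hopf in \<open>simp add: hopf_algebra_def\<close>)
  moreover have "counit H (?m g h) = counit H g * counit H h" for g h
    by (rule deformed_counit_multiplicative[OF alg G \<epsilon> _ diag])
      (use hopf in \<open>simp_all add: hopf_algebra_def\<close>)
  ultimately show ?thesis
    using hopf is_algebra_deform[OF alg G gr] by (simp add: hopf_algebra_def)
qed

lemma comodule_algebra_deform:
  assumes H: "bigraded_hopf_algebra H GH" and A: "bigraded_comodule_algebra H GH A GA \<delta>"
    and \<theta>: "transpose \<theta> = - \<theta>"
  shows "comodule_algebra (deform \<theta> GH H) (deform \<theta> GA A) \<delta>"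
proof -
  have com: "comodule_algebra H A \<delta>" and GA: "direct_sum_decomposition GA" and gr: "graded_mult A GA"
    and graded: "\<And>r l. \<delta> ` GA (r, l) \<subseteq> graded_tensor GA GH r l"
    using A by (auto simp: bigraded_comodule_algebra_def)
  have alg: "is_algebra A" "is_algebra H" and \<delta>: "clinear \<delta>"
    and mult: "\<And>a b. \<delta> (amult A a b) = tensor_mult A H (\<delta> a) (\<delta> b)"
    using com by (simp_all add: comodule_algebra_def hopf_algebra_def)
  have GH: "direct_sum_decomposition GH"
    using H by (simp add: bigraded_hopf_algebra_def)
  show ?thesis
    using com hopf_algebra_deform[OF H \<theta>] is_algebra_deform[OF alg(1) GA gr]
      deformed_coaction_multiplicative[OF alg GA GH \<delta> mult graded]
    by (simp add: comodule_algebra_def)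
qed

text \<open>Closure under products: \<open>\<delta> (x y) = (x \<otimes> 1) (y \<otimes> 1) = x y \<otimes> 1\<close>.\<close>

lemma is_subalgebra_coinvariants:
  assumes com: "comodule_algebra H A \<delta>"
  shows "is_subalgebra A (coinvariants H \<delta>)"
proof -
  have A: "is_algebra A" and H: "is_algebra H" and \<delta>: "clinear \<delta>"
    and mult: "\<And>a b. \<delta> (amult A a b) = tensor_mult A H (\<delta> a) (\<delta> b)"
    and unit: "\<delta> (aunit A) = aunit A \<otimes> aunit H"
    using com by (simp_all add: comodule_algebra_def hopf_algebra_def)
  have "amult A x y \<in> coinvariants H \<delta>" if "x \<in> coinvariants H \<delta>" "y \<in> coinvariants H \<delta>" for x y
    using that A H by (simp add: coinvariants_def mult is_algebra_def cbilinear_tensor_mult(2))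
  moreover have "csubspace (coinvariants H \<delta>)"
    using clinear_zero[OF cbilinear_left[OF cbilinear_pure_tensor], of "aunit H"]
    by (simp add: coinvariants_def complex_vector.subspace_def clinear_zero[OF \<delta>]
        clinear_add[OF \<delta>] clinear_scale[OF \<delta>] pure_tensor_linear)
  ultimately show ?thesis
    using unit by (simp add: is_subalgebra_def coinvariants_def)
qed

theorem proposition4p8:
  fixes H :: "'h::complex_vector hopf"
    and GH :: "(int ^ 'n::finite) \<times> (int ^ 'n) \<Rightarrow> 'h set"
    and A :: "'a::complex_vector calgebra"
    and GA :: "(int ^ 'n) \<times> (int ^ 'n) \<Rightarrow> 'a set"
    and \<delta> :: "'a \<Rightarrow> ('a, 'h) tensor"
    and B :: "'a set"
    and \<theta> :: "real ^ 'n ^ 'n"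
  assumes "bigraded_hopf_algebra H GH"
    and "bigraded_comodule_algebra H GH A GA \<delta>"
    and "hopf_galois_extension H A \<delta> B"
    and "transpose \<theta> = - \<theta>"
  shows "hopf_algebra (deform \<theta> GH H)
    \<and> comodule_algebra (deform \<theta> GH H) (deform \<theta> GA A) \<delta>
    \<and> coinvariants (deform \<theta> GH H) \<delta> = B
    \<and> is_subalgebra (deform \<theta> GA A) B"
proof -
  have com: "comodule_algebra (deform \<theta> GH H) (deform \<theta> GA A) \<delta>"
    by (rule comodule_algebra_deform[OF assms(1,2,4)])
  have coinv: "coinvariants (deform \<theta> GH H) \<delta> = B"
    using assms(3) by (simp add: hopf_galois_extension_def coinvariants_def)
  show ?thesis
    using hopf_algebra_deform[OF assms(1,4)] com coinv is_subalgebra_coinvariants[OF com] by simp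
qed

end
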